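(* Every generalized $\sqrt{J}$-fine ring is $2$-clean.
   Context: Rings are associative with identity, not necessarily commutative. For a ring $R$, $U(R)$ is the group of units, $J(R)$ the Jacobson radical, and $\sqrt{J(R)}=\{x\in R : x^m\in J(R)\text{ for some } m\ge 1\}$. A ring $R$ is called generalized $\sqrt{J}$-fine if every $r\in R\setminus J(R)$ can be written as $r=u+a$ with $u\in U(R)$ and $a\in\sqrt{J(R)}$. A ring is $n$-clean if every element is the sum of an idempotent and $n$ units. *)

theory Defs
  imports "HOL-Algebra.Ideal"
begin

locale left_ideal = additive_subgroup I R + ring R for I and R (structure) +
  assumes l_closed: "\<lbrakk>a \<in> I; x \<in> carrier R\<rbrakk> \<Longrightarrow> x \<otimes> a \<in> I"

definition maximal_left_ideal :: "'a set \<Rightarrow> ('a, 'b) ring_scheme \<Rightarrow> bool"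
  where "maximal_left_ideal M R \<longleftrightarrow>
    left_ideal M R \<and> M \<noteq> carrier R \<and>
    (\<forall>I. left_ideal I R \<and> M \<subseteq> I \<longrightarrow> I = M \<or> I = carrier R)"

text \<open>
  The Jacobson radical is the intersection of all maximal left ideals. Intersecting
  inside the carrier gives the usual convention that the zero ring, which has no
  maximal left ideal, is its own radical.
\<close>
definition jacobson_radical :: "('a, 'b) ring_scheme \<Rightarrow> 'a set"
  where "jacobson_radical R =
    {x \<in> carrier R. \<forall>M. maximal_left_ideal M R \<longrightarrow> x \<in> M}"

definition sqrt_jacobson :: "('a, 'b) ring_scheme \<Rightarrow> 'a set"
  where "sqrt_jacobson R =
    {x \<in> carrier R. \<exists>m::nat. m \<ge> 1 \<and> x [^]\<^bsub>R\<^esub> m \<in> jacobson_radical R}"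

definition generalized_sqrtJ_fine :: "('a, 'b) ring_scheme \<Rightarrow> bool"
  where "generalized_sqrtJ_fine R \<longleftrightarrow>
    (\<forall>r \<in> carrier R - jacobson_radical R.
      \<exists>u \<in> Units R. \<exists>a \<in> sqrt_jacobson R. r = u \<oplus>\<^bsub>R\<^esub> a)"

definition n_clean :: "nat \<Rightarrow> ('a, 'b) ring_scheme \<Rightarrow> bool"
  where "n_clean n R \<longleftrightarrow>
    (\<forall>r \<in> carrier R. \<exists>e \<in> carrier R. \<exists>u \<in> {..<n} \<rightarrow> Units R.
      e \<otimes>\<^bsub>R\<^esub> e = e \<and> r = e \<oplus>\<^bsub>R\<^esub> (\<Oplus>\<^bsub>R\<^esub>i \<in> {..<n}. u i))"

end

theory Submission
  imports Defs
begin

text \<open>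
  If \<open>a\<^sup>m\<close> lies in the Jacobson radical, then \<open>1 - a\<close> divides the unit \<open>1 - a\<^sup>m\<close> on both sides,
  so \<open>a - 1\<close> is a unit. Hence an element \<open>r = u + a\<close> outside the radical is
  \<open>1 + u + (a - 1)\<close>, while an element \<open>r\<close> of the radical is \<open>0 + 1 + (r - 1)\<close>.
\<close>

context ring
begin

section \<open>Left ideals and the existence of maximal ones\<close>

lemma left_idealI:
  assumes "I \<subseteq> carrier R" "\<zero> \<in> I"
    and "\<And>a b. a \<in> I \<Longrightarrow> b \<in> I \<Longrightarrow> a \<oplus> b \<in> I"
    and "\<And>a x. a \<in> I \<Longrightarrow> x \<in> carrier R \<Longrightarrow> x \<otimes> a \<in> I"
  shows "left_ideal I R"
proof -
  have "\<ominus> a \<in> I" if "a \<in> I" for a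
  proof -
    have "\<ominus> a = (\<ominus> \<one>) \<otimes> a"
      using that assms(1) l_minus[of \<one> a] by auto
    then show ?thesis
      using assms(4)[OF that, of "\<ominus> \<one>"] by simp
  qed
  then have "subgroup I (add_monoid R)"
    using assms by (intro add.subgroupI) (auto simp: a_inv_def)
  then have "additive_subgroup I R"
    by (rule additive_subgroup.intro)
  moreover have "left_ideal_axioms I R"
    using assms(4) by (rule left_ideal_axioms.intro)
  ultimately show ?thesis
    using ring_axioms by (intro left_ideal.intro)
qed

lemma left_ideal_one_imp_carrier:
  assumes "left_ideal I R" "\<one> \<in> I"
  shows "I = carrier R"
proof -
  interpret left_ideal I R by (rule assms(1))
  show ?thesis
    using l_closed[OF assms(2)] a_subset by auto
qed

text \<open>Two elements of the union already lie in a common member, namely the larger of the two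
  members containing them. This provides the upper bounds for Zorn's lemma.\<close>

lemma left_ideal_Union_chain:
  assumes "C \<noteq> {}" "\<And>I. I \<in> C \<Longrightarrow> left_ideal I R"
    and "\<And>I K. I \<in> C \<Longrightarrow> K \<in> C \<Longrightarrow> I \<subseteq> K \<or> K \<subseteq> I"
  shows "left_ideal (\<Union>C) R"
proof (rule left_idealI)
  have sub: "additive_subgroup I R" if "I \<in> C" for I
    using assms(2)[OF that] by (rule left_ideal.axioms)
  show "\<Union>C \<subseteq> carrier R"
    using additive_subgroup.a_subset[OF sub] by blast
  show "\<zero> \<in> \<Union>C"
    using assms(1) additive_subgroup.zero_closed[OF sub] by blast
  show "a \<oplus> b \<in> \<Union>C" if ab: "a \<in> \<Union>C" "b \<in> \<Union>C" for a b
  proof -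
    obtain I where "I \<in> C" "a \<in> I" "b \<in> I"
      using ab assms(3) by blast
    then show ?thesis
      using additive_subgroup.a_closed[OF sub] by blast
  qed
  show "x \<otimes> a \<in> \<Union>C" if "a \<in> \<Union>C" "x \<in> carrier R" for a x
    using that left_ideal.l_closed[OF assms(2)] by blast
qed

text \<open>Zorn's lemma on the left ideals above \<open>I\<close> that omit \<open>\<one>\<close>.
  Omitting \<open>\<one>\<close> expresses properness in a form that visibly survives unions of
  chains.\<close>

lemma maximal_left_ideal_exists:
  assumes "left_ideal I R" "\<one> \<notin> I"
  obtains M where "maximal_left_ideal M R" "I \<subseteq> M"
proof -
  let ?A = "{K. left_ideal K R \<and> I \<subseteq> K \<and> \<one> \<notin> K}"
  have "\<exists>M\<in>?A. \<forall>X\<in>?A. M \<subseteq> X \<longrightarrow> X = M"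
  proof (rule subset_Zorn_nonempty)
    show "?A \<noteq> {}"
      using assms by blast
    show "\<Union>C \<in> ?A" if "C \<noteq> {}" "subset.chain ?A C" for C
    proof -
      have "left_ideal (\<Union>C) R"
        using that unfolding subset.chain_def
        by (intro left_ideal_Union_chain) blast+
      then show ?thesis
        using that unfolding subset.chain_def by blast
    qed
  qed
  then obtain M where M: "left_ideal M R" "I \<subseteq> M" "\<one> \<notin> M"
    and max: "\<forall>X\<in>?A. M \<subseteq> X \<longrightarrow> X = M"
    by (elim bexE) (simp, metis)
  \<comment> \<open>Zorn gives maximality only among left ideals omitting \<open>\<one>\<close>. A
    left ideal above \<open>M\<close> that contains \<open>\<one>\<close> is the whole ring, so
    maximality holds among all left ideals.\<close>
  have "X = M \<or> X = carrier R" if "left_ideal X R" "M \<subseteq> X" for X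
  proof (cases "\<one> \<in> X")
    case True
    then show ?thesis
      using left_ideal_one_imp_carrier[OF that(1)] by blast
  next
    case False
    then show ?thesis
      using max that M(2) by simp
  qed
  moreover have "M \<noteq> carrier R"
    using M(3) by auto
  ultimately have "maximal_left_ideal M R"
    using M(1) unfolding maximal_left_ideal_def by simp
  then show thesis
    using M(2) that by blast
qed

lemma left_ideal_principal:
  assumes "x \<in> carrier R"
  shows "left_ideal ((\<lambda>y. y \<otimes> x) ` carrier R) R"
proof (rule left_idealI)
  show "\<zero> \<in> (\<lambda>y. y \<otimes> x) ` carrier R"
    by (rule image_eqI[of _ _ \<zero>]) (use assms in auto)
next
  fix a b assume "a \<in> (\<lambda>y. y \<otimes> x) ` carrier R" "b \<in> (\<lambda>y. y \<otimes> x) ` carrier R"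
  then obtain y z where "y \<in> carrier R" "z \<in> carrier R" "a = y \<otimes> x" "b = z \<otimes> x"
    by blast
  then show "a \<oplus> b \<in> (\<lambda>y. y \<otimes> x) ` carrier R"
    using assms by (intro image_eqI[of _ _ "y \<oplus> z"]) (auto simp: l_distr)
next
  fix a z assume "a \<in> (\<lambda>y. y \<otimes> x) ` carrier R" "z \<in> carrier R"
  then obtain y where "y \<in> carrier R" "a = y \<otimes> x" "z \<in> carrier R"
    by blast
  then show "z \<otimes> a \<in> (\<lambda>y. y \<otimes> x) ` carrier R"
    using assms by (intro image_eqI[of _ _ "z \<otimes> y"]) (auto simp: m_assoc)
qed (use assms in auto)

section \<open>Units of the form one plus a radical element\<close>

lemma jacobson_radical_l_closed:
  assumes "x \<in> jacobson_radical R" "y \<in> carrier R"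
  shows "y \<otimes> x \<in> jacobson_radical R"
proof -
  have "y \<otimes> x \<in> M" if M: "maximal_left_ideal M R" for M
  proof (rule left_ideal.l_closed)
    show "left_ideal M R"
      using M by (simp add: maximal_left_ideal_def)
    show "x \<in> M"
      using assms(1) M by (simp add: jacobson_radical_def)
  qed (rule assms(2))
  then show ?thesis
    using assms by (simp add: jacobson_radical_def)
qed

text \<open>If the left ideal generated by \<open>\<one> \<oplus> x\<close> were proper, a maximal
  left ideal would contain it. That ideal also contains \<open>x\<close>, hence the difference
  \<open>\<one>\<close>, which is absurd.\<close>

lemma one_plus_jacobson_left_invertible:
  assumes "x \<in> jacobson_radical R"
  obtains y where "y \<in> carrier R" "y \<otimes> (\<one> \<oplus> x) = \<one>"
proof -
  have x: "x \<in> carrier R"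
    using assms by (simp add: jacobson_radical_def)
  let ?I = "(\<lambda>y. y \<otimes> (\<one> \<oplus> x)) ` carrier R"
  have I: "left_ideal ?I R"
    using x by (intro left_ideal_principal) simp
  have "\<one> \<in> ?I"
  proof (rule ccontr)
    assume "\<one> \<notin> ?I"
    with I obtain M where M: "maximal_left_ideal M R" "?I \<subseteq> M"
      by (rule maximal_left_ideal_exists)
    interpret left_ideal M R
      using M(1) by (simp add: maximal_left_ideal_def)
    have xM: "x \<in> M"
      using assms M(1) by (simp add: jacobson_radical_def)
    \<comment> \<open>The factor \<open>\<one>\<close> exhibits the generator as the member of the
      image \<open>?I\<close> at \<open>y = \<one>\<close>.\<close>
    have "\<one> \<otimes> (\<one> \<oplus> x) \<in> M"
      using M(2) by blast
    then have "(\<one> \<oplus> x) \<oplus> \<ominus> x \<in> M"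
      using xM x a_closed a_inv_closed by simp
    then have "\<one> \<in> M"
      using x by (simp add: a_assoc r_neg)
    then show False
      using M(1) left_ideal_one_imp_carrier[of M] unfolding maximal_left_ideal_def by blast
  qed
  then show thesis
    using that by force
qed

lemma one_plus_jacobson_Units:
  assumes "x \<in> jacobson_radical R"
  shows "\<one> \<oplus> x \<in> Units R"
proof -
  have x: "x \<in> carrier R"
    using assms by (simp add: jacobson_radical_def)
  obtain y where y: "y \<in> carrier R" "y \<otimes> (\<one> \<oplus> x) = \<one>"
    using assms by (rule one_plus_jacobson_left_invertible)
  \<comment> \<open>\<open>y = 1 - y x\<close> is itself one plus a radical element, so its right inverse is also a left inverse.\<close>
  have "(\<ominus> y) \<otimes> x \<in> jacobson_radical R"
    using assms y(1) by (intro jacobson_radical_l_closed) auto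
  then obtain z where z: "z \<in> carrier R" "z \<otimes> (\<one> \<oplus> (\<ominus> y) \<otimes> x) = \<one>"
    by (rule one_plus_jacobson_left_invertible)
  have "y \<oplus> y \<otimes> x = \<one>"
    using y x by (simp add: r_distr)
  then have "\<one> \<oplus> (\<ominus> y) \<otimes> x = y"
    using x y(1) by (metis a_assoc l_minus m_closed r_neg r_zero add.inv_closed)
  then have zy: "z \<otimes> y = \<one>"
    using z(2) by simp
  then have "z = \<one> \<oplus> x"
    using x y z(1) by (metis a_closed inv_unique one_closed)
  then show ?thesis
    using x y zy by (auto simp: Units_def)
qed

section \<open>Geometric sums and the units obtained from \<open>sqrt_jacobson\<close>\<close>

lemma geometric_factor:
  assumes "a \<in> carrier R"
  shows "\<exists>s\<in>carrier R. (\<one> \<ominus> a) \<otimes> s = \<one> \<ominus> a [^] (n::nat) \<and> s \<otimes> (\<one> \<ominus> a) = \<one> \<ominus> a [^] n"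
proof (induction n)
  case 0
  \<comment> \<open>The witness \<open>s\<close> is the geometric sum of the powers of
    \<open>a\<close> with exponent below \<open>n\<close>, so it is the empty sum
    \<open>\<zero>\<close> here. The induction step adds \<open>a [^] n\<close>.\<close>
  show ?case
    using assms by (intro bexI[of _ \<zero>]) (auto simp: minus_eq r_neg)
next
  case (Suc n)
  then obtain s where s: "s \<in> carrier R"
    "(\<one> \<ominus> a) \<otimes> s = \<one> \<ominus> a [^] n" "s \<otimes> (\<one> \<ominus> a) = \<one> \<ominus> a [^] n"
    by blast
  let ?p = "a [^] n"
  \<comment> \<open>Since \<open>a\<close> commutes with its powers, the same sum works as a
    cofactor of \<open>\<one> \<ominus> a\<close> on either side, even in a noncommutative
    ring.\<close>
  have p: "?p \<in> carrier R" "a \<otimes> ?p = a [^] Suc n" "?p \<otimes> a = a [^] Suc n"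
    using assms nat_pow_Suc2[of a n] by auto
  \<comment> \<open>The telescoping step: the induction hypothesis contributes the first difference
    and the new summand \<open>?p\<close> the second. With \<open>a [^] Suc n\<close> kept as an
    atom, this is purely additive cancellation.\<close>
  have "\<one> \<ominus> ?p \<oplus> (?p \<ominus> a [^] Suc n) = \<one> \<ominus> a [^] Suc n"
    using p(1) nat_pow_closed[OF assms, of "Suc n"]
    by (simp add: minus_eq a_assoc r_neg1 l_neg r_neg2 del: nat_pow_Suc)
  moreover have "(\<one> \<ominus> a) \<otimes> ?p = ?p \<ominus> a [^] Suc n" "?p \<otimes> (\<one> \<ominus> a) = ?p \<ominus> a [^] Suc n"
    using assms p by (simp_all only: minus_eq l_distr r_distr l_minus r_minus l_one r_one
        one_closed add.inv_closed)
  ultimately have "(\<one> \<ominus> a) \<otimes> (s \<oplus> ?p) = \<one> \<ominus> a [^] Suc n"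
    "(s \<oplus> ?p) \<otimes> (\<one> \<ominus> a) = \<one> \<ominus> a [^] Suc n"
    using assms s p(1) by (simp_all only: l_distr r_distr minus_closed one_closed)
  then show ?case
    using s(1) p(1) by blast
qed

lemma sqrt_jacobson_minus_one_Units:
  assumes "a \<in> sqrt_jacobson R"
  shows "a \<ominus> \<one> \<in> Units R"
proof -
  obtain m :: nat where a: "a \<in> carrier R" and m: "a [^] m \<in> jacobson_radical R"
    using assms by (auto simp: sqrt_jacobson_def)
  obtain s where s: "s \<in> carrier R"
    "(\<one> \<ominus> a) \<otimes> s = \<one> \<ominus> a [^] m" "s \<otimes> (\<one> \<ominus> a) = \<one> \<ominus> a [^] m"
    using geometric_factor[OF a] by blast
  \<comment> \<open>The sign is written as a left factor because closure of the radical under left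
    multiplication is what has been proved.\<close>
  have "\<one> \<oplus> (\<ominus> \<one>) \<otimes> a [^] m \<in> Units R"
    using m by (intro one_plus_jacobson_Units jacobson_radical_l_closed) auto
  then have w: "\<one> \<ominus> a [^] m \<in> Units R"
    using a by (simp add: minus_eq l_minus)
  let ?w = "inv (\<one> \<ominus> a [^] m)"
  let ?d = "\<one> \<ominus> a"
  have d: "?d \<in> carrier R"
    using a by simp
  \<comment> \<open>The two products are a right and a left inverse of \<open>?d\<close>: in each,
    \<open>?w\<close> stands on the outside and cancels the unit formed by \<open>?d\<close> and
    \<open>s\<close>. A left and a right inverse of one element coincide.\<close>
  have sw: "s \<otimes> ?w \<in> carrier R" "?w \<otimes> s \<in> carrier R"
    using s(1) Units_inv_closed[OF w] by (blast intro: m_closed)+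
  have r_inv: "?d \<otimes> (s \<otimes> ?w) = \<one>"
    using d s(1,2) w by (metis Units_inv_closed Units_r_inv m_assoc)
  have l_inv: "(?w \<otimes> s) \<otimes> ?d = \<one>"
    using d s(1,3) w by (metis Units_inv_closed Units_l_inv m_assoc)
  have "?w \<otimes> s = s \<otimes> ?w"
    using l_inv r_inv d sw(2,1) by (rule inv_unique)
  then have "?d \<in> Units R"
    using d sw(1) l_inv r_inv unfolding Units_def by auto
  moreover have "\<ominus> \<one> \<in> Units R"
    using Units_minus_one_closed by blast
  ultimately have "(\<ominus> \<one>) \<otimes> ?d \<in> Units R"
    by blast
  moreover have "(\<ominus> \<one>) \<otimes> ?d = a \<ominus> \<one>"
    using a by (simp add: minus_eq l_minus minus_add a_comm)
  ultimately show ?thesis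
    by simp
qed

section \<open>From sums of an idempotent and two units to the theorem\<close>

lemma n_clean_2I:
  assumes "\<And>r. r \<in> carrier R \<Longrightarrow>
    \<exists>e\<in>carrier R. \<exists>u\<in>Units R. \<exists>v\<in>Units R. e \<otimes> e = e \<and> r = e \<oplus> (u \<oplus> v)"
  shows "n_clean 2 R"
  unfolding n_clean_def
proof
  fix r assume "r \<in> carrier R"
  then obtain e u v where e: "e \<in> carrier R" "e \<otimes> e = e" "r = e \<oplus> (u \<oplus> v)"
    and uv: "u \<in> Units R" "v \<in> Units R"
    using assms by blast
  \<comment> \<open>The pair becomes a family indexed by \<open>{..<2}\<close>, as
    \<open>n_clean\<close> requires; the else branch matters only at index 1.\<close>
  let ?f = "\<lambda>i::nat. if i = 0 then u else v"
  have "(\<Oplus>i\<in>{..<2}. ?f i) = u \<oplus> v"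
    using uv by (simp add: lessThan_nat_numeral lessThan_Suc Units_closed a_comm)
  then show "\<exists>e\<in>carrier R. \<exists>u\<in>{..<2::nat} \<rightarrow> Units R. e \<otimes> e = e \<and> r = e \<oplus> (\<Oplus>i\<in>{..<2}. u i)"
    using e uv by (intro bexI[of _ e] bexI[of _ ?f]) auto
qed

end

theorem theorem2p19:
  fixes R :: "('a, 'b) ring_scheme"
  assumes "ring R"
    and "generalized_sqrtJ_fine R"
  shows "n_clean 2 R"
proof -
  interpret ring R by (rule assms(1))
  show ?thesis
  proof (rule n_clean_2I)
    fix r assume r: "r \<in> carrier R"
    show "\<exists>e\<in>carrier R. \<exists>u\<in>Units R. \<exists>v\<in>Units R. e \<otimes>\<^bsub>R\<^esub> e = e \<and> r = e \<oplus>\<^bsub>R\<^esub> (u \<oplus>\<^bsub>R\<^esub> v)"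
    proof (cases "r \<in> jacobson_radical R")
      case True
      \<comment> \<open>Exponent 1 places \<open>r\<close> itself in \<open>sqrt_jacobson R\<close>,
        so \<open>r \<ominus> \<one>\<close> is a unit by the same lemma that treats
        \<open>a\<close> in the other case.\<close>
      then have "r [^]\<^bsub>R\<^esub> (1::nat) \<in> jacobson_radical R"
        using r by simp
      then have "r \<in> sqrt_jacobson R"
        using r by (auto simp: sqrt_jacobson_def)
      then have "r \<ominus>\<^bsub>R\<^esub> \<one>\<^bsub>R\<^esub> \<in> Units R"
        by (rule sqrt_jacobson_minus_one_Units)
      moreover have "r = \<zero>\<^bsub>R\<^esub> \<oplus>\<^bsub>R\<^esub> (\<one>\<^bsub>R\<^esub> \<oplus>\<^bsub>R\<^esub> (r \<ominus>\<^bsub>R\<^esub> \<one>\<^bsub>R\<^esub>))"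
        using r by (simp add: minus_eq a_lcomm r_neg)
      ultimately show ?thesis
        by (metis Units_one_closed l_null zero_closed)
    next
      case False
      then obtain u a where u: "u \<in> Units R" and a: "a \<in> sqrt_jacobson R" "r = u \<oplus>\<^bsub>R\<^esub> a"
        using assms(2) r unfolding generalized_sqrtJ_fine_def by blast
      have "a \<in> carrier R" "u \<in> carrier R"
        using a(1) u by (auto simp: sqrt_jacobson_def)
      then have "r = \<one>\<^bsub>R\<^esub> \<oplus>\<^bsub>R\<^esub> (u \<oplus>\<^bsub>R\<^esub> (a \<ominus>\<^bsub>R\<^esub> \<one>\<^bsub>R\<^esub>))"
        using a(2) by (simp add: minus_eq a_lcomm r_neg a_comm)
      then show ?thesis
        using u sqrt_jacobson_minus_one_Units[OF a(1)] by (metis one_closed l_one)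
    qed
  qed
qed

end
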